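(* Let $g\in C(\mathbb{R},\mathbb{R})$ be such that there exists $s_0\ge 0$ with $g\ge 0$ on $[s_0,\infty)$ and $g\le 0$ on $(-\infty,-s_0]$. Let $\Omega$ be a connected open subset of $\mathbb{R}^n$, and suppose that $u\in C^2(\Omega)$ solves $$\Delta_\infty u+g(u)|Du|^4=0\quad\text{in }\Omega.$$ Then either $Du\ne 0$ in $\Omega$ (that is, $Du(x)\neq 0$ for every $x\in\Omega$) or $u$ reduces to a constant.
   Context: The infinity-Laplacian is $\Delta_\infty u=\langle D^2u\,Du,Du\rangle$. The equation is understood in the classical pointwise sense. *)

theory Defs
  imports "HOL-Analysis.Analysis"
begin

definition partial_deriv :: "'n \<Rightarrow> (real ^ 'n \<Rightarrow> real) \<Rightarrow> real ^ 'n \<Rightarrow> real" where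
  "partial_deriv i f x = frechet_derivative f (at x) (axis i 1)"

definition gradient :: "(real ^ 'n \<Rightarrow> real) \<Rightarrow> real ^ 'n \<Rightarrow> real ^ 'n" where
  "gradient f x = (\<chi> i. partial_deriv i f x)"

definition hessian :: "(real ^ 'n \<Rightarrow> real) \<Rightarrow> real ^ 'n \<Rightarrow> real ^ 'n ^ 'n" where
  "hessian f x = (\<chi> i j. partial_deriv i (partial_deriv j f) x)"

definition infinity_laplacian :: "(real ^ 'n \<Rightarrow> real) \<Rightarrow> real ^ 'n \<Rightarrow> real" where
  "infinity_laplacian f x = (hessian f x *v gradient f x) \<bullet> gradient f x"

(* Both predicates are meant for open S, where "differentiable_on" (a derivative within S)
   agrees with differentiability at each point, as used in partial_deriv. *)
definition C1_on :: "(real ^ 'n) set \<Rightarrow> (real ^ 'n \<Rightarrow> real) \<Rightarrow> bool" where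
  "C1_on S f \<longleftrightarrow> f differentiable_on S \<and> (\<forall>i. continuous_on S (partial_deriv i f))"

definition C2_on :: "(real ^ 'n) set \<Rightarrow> (real ^ 'n \<Rightarrow> real) \<Rightarrow> bool" where
  "C2_on S f \<longleftrightarrow> C1_on S f \<and> (\<forall>i. C1_on S (partial_deriv i f))"

end

theory Submission
  imports Defs
begin

text \<open>
  If \<open>G' = g\<close>, then \<open>v = \<phi>(u)\<close> with \<open>\<phi>' = exp \<circ> G\<close> is infinity-harmonic, and its gradient
  \<open>V = exp (G u) Du\<close> is a \<open>C\<^sup>1\<close> field whose derivative \<open>A\<close> is self-adjoint with \<open>\<langle>A V, V\<rangle> = 0\<close>.
  Put \<open>w = |V|\<^sup>2\<close>, so that \<open>Dw = 2 A V\<close>. Since \<open>w\<close> is constant along the flow of \<open>V\<close>, any \<open>C\<^sup>2\<close>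
  function \<open>\<psi>\<close> such that \<open>w - \<psi>\<close> has a local minimum at \<open>z\<close> satisfies
  \<open>\<langle>D\<^sup>2\<psi> V, V\<rangle> + |D\<psi>|\<^sup>2 / 2 \<le> 0\<close> at \<open>z\<close>. This excludes a negative minimum for a Gaussian barrier
  \<open>\<psi> = k (exp (- \<alpha> |x - y|\<^sup>2) - exp (- \<alpha> R\<^sup>2))\<close> on an annulus around a point \<open>y\<close> with
  \<open>V y \<noteq> 0\<close>. Hence \<open>V\<close> has no zero in the ball of radius \<open>R\<close> around \<open>y\<close>, so that the zero set of
  \<open>V\<close> is open and closed.
\<close>

section \<open>Derivatives along lines and symmetry of second derivatives\<close>

lemma has_real_derivative_along_line:
  fixes f :: "'a::real_normed_vector \<Rightarrow> real"
  assumes "(f has_derivative f') (at (x + s *\<^sub>R a))"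
  shows "((\<lambda>s. f (x + s *\<^sub>R a)) has_real_derivative f' a) (at s)"
proof -
  have "((\<lambda>s. x + s *\<^sub>R a) has_derivative (\<lambda>h. h *\<^sub>R a)) (at s)"
    by (auto intro!: derivative_eq_intros)
  then have "((\<lambda>s. f (x + s *\<^sub>R a)) has_derivative (\<lambda>h. f' (h *\<^sub>R a))) (at s)"
    using assms by (rule has_derivative_compose)
  moreover have "f' (h *\<^sub>R a) = f' a * h" for h
    using has_derivative_bounded_linear[OF assms] by (simp add: linear_simps)
  ultimately show ?thesis
    by (simp add: has_field_derivative_def)
qed

text \<open>The mean value theorem is used twice: along \<open>a\<close> for the increment of
  \<open>f\<close> caused by the shift \<open>h *\<^sub>R b\<close>, then along \<open>b\<close> for
  the directional derivative that results.\<close>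

lemma second_difference_mean_value:
  fixes f :: "'a::real_normed_vector \<Rightarrow> real"
  assumes "h > 0"
    and S: "\<And>p q. 0 \<le> p \<Longrightarrow> p \<le> h \<Longrightarrow> 0 \<le> q \<Longrightarrow> q \<le> h \<Longrightarrow> x + p *\<^sub>R a + q *\<^sub>R b \<in> S"
    and f: "\<And>y. y \<in> S \<Longrightarrow> (f has_derivative f' y) (at y)"
    and fa: "\<And>y. y \<in> S \<Longrightarrow> ((\<lambda>y. f' y a) has_derivative fa' y) (at y)"
  obtains p q where "0 < p" "p < h" "0 < q" "q < h"
    "f (x + h *\<^sub>R a + h *\<^sub>R b) - f (x + h *\<^sub>R a) - f (x + h *\<^sub>R b) + f x
      = h^2 * fa' (x + p *\<^sub>R a + q *\<^sub>R b) b"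
proof -
  let ?\<phi> = "\<lambda>s. f (x + h *\<^sub>R b + s *\<^sub>R a) - f (x + s *\<^sub>R a)"
  have d: "(?\<phi> has_real_derivative
      f' (x + h *\<^sub>R b + s *\<^sub>R a) a - f' (x + s *\<^sub>R a) a) (at s)" if "0 \<le> s" "s \<le> h" for s
    using S[of s h] S[of s 0] that \<open>h > 0\<close>
    by (intro DERIV_diff has_real_derivative_along_line f) (auto simp: algebra_simps)
  obtain p where p: "0 < p" "p < h"
    and 1: "?\<phi> h - ?\<phi> 0 = (h - 0) * (f' (x + h *\<^sub>R b + p *\<^sub>R a) a - f' (x + p *\<^sub>R a) a)"
    using MVT2[OF \<open>h > 0\<close> d] by auto
  let ?\<psi> = "\<lambda>s. f' (x + p *\<^sub>R a + s *\<^sub>R b) a"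
  have "(?\<psi> has_real_derivative fa' (x + p *\<^sub>R a + s *\<^sub>R b) b) (at s)" if "0 \<le> s" "s \<le> h" for s
    using S[of p s] that p by (intro has_real_derivative_along_line fa) auto
  from MVT2[OF \<open>h > 0\<close> this] obtain q where q: "0 < q" "q < h"
    and 2: "?\<psi> h - ?\<psi> 0 = (h - 0) * fa' (x + p *\<^sub>R a + q *\<^sub>R b) b" by blast
  have "f (x + h *\<^sub>R a + h *\<^sub>R b) - f (x + h *\<^sub>R a) - f (x + h *\<^sub>R b) + f x = ?\<phi> h - ?\<phi> 0"
    by (simp add: algebra_simps)
  also have "\<dots> = h * (?\<psi> h - ?\<psi> 0)"
    unfolding 1 by (simp add: algebra_simps)
  also have "\<dots> = h^2 * fa' (x + p *\<^sub>R a + q *\<^sub>R b) b"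
    unfolding 2 by (simp add: power2_eq_square)
  finally show thesis using that p q by blast
qed

text \<open>Swapping \<open>a\<close> and \<open>b\<close> leaves the second difference unchanged
  but expresses it through \<open>fb'\<close> instead of \<open>fa'\<close>. By continuity both
  values, taken at points close to \<open>x\<close>, are close to those at \<open>x\<close>.\<close>

lemma second_derivative_symmetric:
  fixes f :: "'a::real_normed_vector \<Rightarrow> real"
  assumes S: "open S" "x \<in> S"
    and f: "\<And>y. y \<in> S \<Longrightarrow> (f has_derivative f' y) (at y)"
    and fa: "\<And>y. y \<in> S \<Longrightarrow> ((\<lambda>y. f' y a) has_derivative fa' y) (at y)"
    and fb: "\<And>y. y \<in> S \<Longrightarrow> ((\<lambda>y. f' y b) has_derivative fb' y) (at y)"
    and ca: "continuous_on S (\<lambda>y. fa' y b)"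
    and cb: "continuous_on S (\<lambda>y. fb' y a)"
  shows "fa' x b = fb' x a"
proof (rule ccontr)
  \<comment> \<open>Half the gap, so that two errors below \<open>e\<close> cannot bridge
    it.\<close>
  define e where "e = \<bar>fa' x b - fb' x a\<bar> / 2"
  assume "fa' x b \<noteq> fb' x a"
  then have "e > 0" by (simp add: e_def)
  have "eventually (\<lambda>y. y \<in> S \<and> dist (fa' y b) (fa' x b) < e \<and> dist (fb' y a) (fb' x a) < e) (nhds x)"
  proof (intro eventually_conj)
    show "eventually (\<lambda>y. y \<in> S) (nhds x)"
      using S by (simp add: eventually_nhds_in_open)
    have "isCont (\<lambda>y. fa' y b) x" "isCont (\<lambda>y. fb' y a) x"
      using ca cb S by (simp_all add: continuous_on_eq_continuous_at)
    then show "eventually (\<lambda>y. dist (fa' y b) (fa' x b) < e) (nhds x)"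
      "eventually (\<lambda>y. dist (fb' y a) (fb' x a) < e) (nhds x)"
      using \<open>e > 0\<close> by (auto simp: isCont_def tendsto_iff eventually_nhds_conv_at)
  qed
  then obtain d where "d > 0" and d: "\<And>y. dist y x < d \<Longrightarrow>
      y \<in> S \<and> dist (fa' y b) (fa' x b) < e \<and> dist (fb' y a) (fb' x a) < e"
    by (auto simp: eventually_nhds_metric)
  \<comment> \<open>With this size the parallelogram spanned by \<open>h *\<^sub>R a\<close> and
    \<open>h *\<^sub>R b\<close> at \<open>x\<close> stays within distance \<open>d\<close>. The
    summand 1 keeps the denominator positive and the estimate strict.\<close>
  define h where "h = d / (norm a + norm b + 1)"
  have "h > 0" using \<open>d > 0\<close> by (simp add: h_def add_nonneg_pos)
  have near: "dist (x + p *\<^sub>R a + q *\<^sub>R b) x < d" if "0 \<le> p" "p \<le> h" "0 \<le> q" "q \<le> h" for p q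
  proof -
    have "dist (x + p *\<^sub>R a + q *\<^sub>R b) x = norm (p *\<^sub>R a + q *\<^sub>R b)"
      by (simp add: dist_norm add.assoc)
    also have "\<dots> \<le> p * norm a + q * norm b"
      using norm_triangle_ineq[of "p *\<^sub>R a" "q *\<^sub>R b"] that by simp
    also have "\<dots> \<le> h * norm a + h * norm b"
      using that by (intro add_mono mult_right_mono) auto
    also have "\<dots> < h * (norm a + norm b + 1)"
      using \<open>h > 0\<close> by (simp add: algebra_simps)
    also have "\<dots> = d"
      using norm_ge_zero[of a] norm_ge_zero[of b] by (simp add: h_def add_nonneg_pos less_imp_neq[symmetric])
    finally show ?thesis .
  qed
  have in_S: "x + p *\<^sub>R a + q *\<^sub>R b \<in> S" if "0 \<le> p" "p \<le> h" "0 \<le> q" "q \<le> h" for p q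
    using near[OF that] d by blast
  have in_S': "x + p *\<^sub>R b + q *\<^sub>R a \<in> S" if "0 \<le> p" "p \<le> h" "0 \<le> q" "q \<le> h" for p q
    using in_S[of q p] that by (simp add: algebra_simps)
  obtain p q where pq: "0 < p" "p < h" "0 < q" "q < h"
    "f (x + h *\<^sub>R a + h *\<^sub>R b) - f (x + h *\<^sub>R a) - f (x + h *\<^sub>R b) + f x
      = h^2 * fa' (x + p *\<^sub>R a + q *\<^sub>R b) b"
    by (rule second_difference_mean_value[OF \<open>h > 0\<close> in_S f fa])
  obtain p' q' where pq': "0 < p'" "p' < h" "0 < q'" "q' < h"
    "f (x + h *\<^sub>R b + h *\<^sub>R a) - f (x + h *\<^sub>R b) - f (x + h *\<^sub>R a) + f x
      = h^2 * fb' (x + p' *\<^sub>R b + q' *\<^sub>R a) a"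
    by (rule second_difference_mean_value[OF \<open>h > 0\<close> in_S' f fb])
  have "h^2 * fa' (x + p *\<^sub>R a + q *\<^sub>R b) b = h^2 * fb' (x + p' *\<^sub>R b + q' *\<^sub>R a) a"
    using pq(5) pq'(5) by (simp add: algebra_simps)
  then have "fa' (x + p *\<^sub>R a + q *\<^sub>R b) b = fb' (x + q' *\<^sub>R a + p' *\<^sub>R b) a"
    using \<open>h > 0\<close> by (simp add: algebra_simps)
  moreover have "dist (fa' (x + p *\<^sub>R a + q *\<^sub>R b) b) (fa' x b) < e"
    using d near pq by (meson less_imp_le)
  moreover have "dist (fb' (x + q' *\<^sub>R a + p' *\<^sub>R b) a) (fb' x a) < e"
    using d near pq' by (meson less_imp_le)
  ultimately have "dist (fa' x b) (fb' x a) < e + e"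
    by (metis dist_commute dist_triangle_less_add)
  then show False
    by (simp add: dist_real_def e_def)
qed

section \<open>Second-order minimum test and the barrier argument\<close>

text \<open>At a minimum \<open>f' 0\<close> vanishes, so \<open>D < 0\<close> makes
  \<open>f'\<close> negative just to the right of 0 and \<open>f\<close> drops below
  \<open>f 0\<close>. Differentiability of \<open>f'\<close> is asked for at 0 only, which is what
  the flow estimate below supplies.\<close>

lemma no_local_min_if_second_derivative_neg:
  fixes f :: "real \<Rightarrow> real"
  assumes "d > 0"
    and f: "\<And>t. \<bar>t\<bar> < d \<Longrightarrow> (f has_real_derivative f' t) (at t)"
    and f': "(f' has_real_derivative D) (at 0)" and "D < 0"
    and min: "\<And>t. \<bar>t\<bar> < d \<Longrightarrow> f 0 \<le> f t"
  shows False
proof -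
  have "f' 0 = 0"
    using DERIV_local_min[OF f[of 0] \<open>d > 0\<close>] min \<open>d > 0\<close> by simp
  obtain e where e: "e > 0" "\<And>h. h > 0 \<Longrightarrow> h < e \<Longrightarrow> f' h < 0"
    using DERIV_neg_dec_right[OF f' \<open>D < 0\<close>] \<open>f' 0 = 0\<close> by auto
  define t where "t = min d e / 2"
  have t: "0 < t" "t < d" "t < e" using \<open>d > 0\<close> e(1) by (auto simp: t_def)
  obtain s where s: "0 < s" "s < t" "f t - f 0 = (t - 0) * f' s"
    using MVT2[OF t(1), of f f'] f t by force
  then have "f t < f 0"
    using e(2)[of s] t mult_pos_neg[of t "f' s"] by simp
  then show False using min[of t] t by simp
qed

text \<open>The curve \<open>c\<close> agrees to second order with the integral curve of \<open>V\<close> through \<open>z\<close>, along which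
  the norm of \<open>V\<close> is constant. This replaces differentiating \<open>norm (V x) ^ 2\<close> twice, which
  is not possible when \<open>V\<close> is merely \<open>C\<^sup>1\<close>.\<close>

lemma norm_squared_flat_along_flow:
  fixes V :: "'a::real_inner \<Rightarrow> 'a"
  assumes S: "open S" "z \<in> S"
    and V: "\<And>x. x \<in> S \<Longrightarrow> (V has_derivative A x) (at x)"
    and sym: "\<And>x \<xi> \<eta>. x \<in> S \<Longrightarrow> A x \<xi> \<bullet> \<eta> = \<xi> \<bullet> A x \<eta>"
    and null: "\<And>x. x \<in> S \<Longrightarrow> A x (V x) \<bullet> V x = 0"
    and cont: "continuous_on S (\<lambda>x. A x (V x))"
  defines "c \<equiv> \<lambda>t. z + t *\<^sub>R V z + (t^2 / 2) *\<^sub>R A z (V z)"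
  obtains d \<omega> where "d > 0" "\<And>t. \<bar>t\<bar> < d \<Longrightarrow> c t \<in> S"
    "\<And>t. \<bar>t\<bar> < d \<Longrightarrow> ((\<lambda>t. V (c t) \<bullet> V (c t)) has_real_derivative \<omega> t) (at t)"
    "(\<omega> has_real_derivative 0) (at 0)"
proof -
  let ?B = "A z (V z)"
  have c': "(c has_vector_derivative (V z + t *\<^sub>R ?B)) (at t)" for t
    unfolding c_def has_vector_derivative_def
    by (auto intro!: derivative_eq_intros simp: algebra_simps)
  have c0: "c 0 = z" by (simp add: c_def)
  have "isCont c t" for t
    using c' has_vector_derivative_continuous by blast
  then have "open (c -` S)"
    by (simp add: S(1) open_vimage continuous_at_imp_continuous_on)
  then obtain d where d: "d > 0" "\<And>t. \<bar>t\<bar> < d \<Longrightarrow> c t \<in> S"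
    using S(2) c0 unfolding open_dist by (force simp: dist_real_def)
  \<comment> \<open>Since \<open>c\<close> has velocity \<open>V z + t *\<^sub>R ?B\<close>,
    \<open>m\<close> measures how far \<open>c\<close> is from being an integral curve of
    \<open>V\<close>.\<close>
  define m where "m = (\<lambda>t. V z + t *\<^sub>R ?B - V (c t))"
  define n where "n = (\<lambda>t. A (c t) (V (c t)))"
  define \<omega> where "\<omega> = (\<lambda>t. 2 * (m t \<bullet> n t))"
  have Vc: "((\<lambda>t. V (c t)) has_vector_derivative A (c t) (V z + t *\<^sub>R ?B)) (at t)"
    if "\<bar>t\<bar> < d" for t
  proof -
    have "((\<lambda>t. V (c t)) has_derivative (\<lambda>h. A (c t) (h *\<^sub>R (V z + t *\<^sub>R ?B)))) (at t)"
      using c'[of t] V[OF d(2)[OF that]] unfolding has_vector_derivative_def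
      by (rule has_derivative_compose)
    then show ?thesis
      using has_derivative_bounded_linear[OF V[OF d(2)[OF that]]]
      by (simp add: has_vector_derivative_def linear_simps)
  qed
  have "((\<lambda>t. V (c t) \<bullet> V (c t)) has_real_derivative \<omega> t) (at t)" if "\<bar>t\<bar> < d" for t
  proof -
    have "((\<lambda>t. V (c t) \<bullet> V (c t)) has_real_derivative
        2 * (A (c t) (V z + t *\<^sub>R ?B) \<bullet> V (c t))) (at t)"
      using Vc[OF that] unfolding has_vector_derivative_def has_field_derivative_def
      by (auto intro!: derivative_eq_intros simp: inner_commute)
    moreover have "A (c t) (V z + t *\<^sub>R ?B) \<bullet> V (c t) = (V z + t *\<^sub>R ?B) \<bullet> n t"
      unfolding n_def by (rule sym[OF d(2)[OF that]])
    \<comment> \<open>This orthogonality allows the velocity of \<open>c\<close> to be replaced by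
      the small defect \<open>m t\<close>.\<close>
    moreover have "V (c t) \<bullet> n t = 0"
      using null[OF d(2)[OF that]] by (simp add: n_def inner_commute)
    ultimately have "((\<lambda>t. V (c t) \<bullet> V (c t)) has_real_derivative 2 * (m t \<bullet> n t)) (at t)"
      by (simp add: m_def inner_diff_left)
    then show ?thesis by (simp add: \<omega>_def)
  qed
  moreover have "(\<omega> has_real_derivative 0) (at 0)"
  proof -
    have "(m has_vector_derivative 0) (at 0)"
      using Vc[of 0] d(1) unfolding m_def
      by (auto intro!: derivative_eq_intros simp: c0)
    then have "((\<lambda>h. norm (m h /\<^sub>R norm h)) \<longlongrightarrow> 0) (at 0)"
      by (simp add: has_vector_derivative_def has_derivative_at m_def c0 divide_inverse mult.commute)
    then have "((\<lambda>h. m h /\<^sub>R norm h) \<longlongrightarrow> 0) (at 0)"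
      by (rule tendsto_norm_zero_cancel)
    moreover have "(n \<longlongrightarrow> n 0) (at 0)"
    proof -
      have "isCont (\<lambda>x. A x (V x)) (c 0)"
        using cont S c0 by (simp add: continuous_on_eq_continuous_at)
      then have "isCont n 0"
        unfolding n_def using \<open>isCont c 0\<close> by (rule isCont_o2[rotated])
      then show ?thesis by (simp add: isCont_def)
    qed
    ultimately have "((\<lambda>h. (m h /\<^sub>R norm h) \<bullet> n h) \<longlongrightarrow> 0 \<bullet> n 0) (at 0)"
      by (rule tendsto_inner)
    then have "((\<lambda>h. 2 * \<bar>(m h /\<^sub>R norm h) \<bullet> n h\<bar>) \<longlongrightarrow> 2 * \<bar>0 \<bullet> n 0\<bar>) (at 0)"
      by (intro tendsto_mult tendsto_const tendsto_rabs)
    moreover have "bounded_linear ((*) (0::real))"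
      by (rule bounded_linear_mult_right)
    ultimately show ?thesis
      unfolding has_field_derivative_def has_derivative_at
      by (auto simp: \<omega>_def m_def c0 abs_mult divide_inverse ac_simps)
  qed
  ultimately show thesis using that d by blast
qed

text \<open>The barrier lies below \<open>V x \<bullet> V x\<close> on both boundary spheres of the
  annulus, so a negative minimum of the difference would be interior. There the first-order
  condition determines \<open>A z (V z)\<close>, and the second derivative along the flow has the
  wrong sign.\<close>

lemma nonzero_in_ball:
  fixes V :: "'a::euclidean_space \<Rightarrow> 'a"
  assumes S: "open S" "cball y R \<subseteq> S"
    and V: "\<And>x. x \<in> S \<Longrightarrow> (V has_derivative A x) (at x)"
    and sym: "\<And>x \<xi> \<eta>. x \<in> S \<Longrightarrow> A x \<xi> \<bullet> \<eta> = \<xi> \<bullet> A x \<eta>"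
    and null: "\<And>x. x \<in> S \<Longrightarrow> A x (V x) \<bullet> V x = 0"
    and cont: "continuous_on S (\<lambda>x. A x (V x))"
    and "V y \<noteq> 0" and "dist y x < R"
  shows "V x \<noteq> 0"
proof -
  have "R > 0" using \<open>dist y x < R\<close> by (metis zero_le_dist le_less_trans)
  \<comment> \<open>Half of the value at \<open>y\<close>, so that \<open>V x \<bullet> V x\<close>
    still exceeds \<open>k\<close> on a small closed ball around \<open>y\<close>.\<close>
  define k where "k = (V y \<bullet> V y) / 2"
  have "k > 0" using \<open>V y \<noteq> 0\<close> by (simp add: k_def)
  have cV: "continuous_on S V"
    using V by (meson continuous_at_imp_continuous_on has_derivative_continuous)
  have "y \<in> S" using S(2) \<open>R > 0\<close> by auto
  then have "isCont (\<lambda>x. V x \<bullet> V x) y"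
    using V has_derivative_continuous by (intro continuous_intros) blast+
  moreover have "V y \<bullet> V y > k" using \<open>k > 0\<close> by (simp add: k_def)
  ultimately have "eventually (\<lambda>x. V x \<bullet> V x > k) (nhds y)"
    by (auto simp: isCont_def eventually_nhds_conv_at dest: order_tendstoD(1))
  then obtain \<epsilon>' where "\<epsilon>' > 0" and \<epsilon>': "\<And>x. dist x y < \<epsilon>' \<Longrightarrow> V x \<bullet> V x > k"
    by (auto simp: eventually_nhds_metric)
  define \<epsilon> where "\<epsilon> = \<epsilon>' / 2"
  have "\<epsilon> > 0" using \<open>\<epsilon>' > 0\<close> by (simp add: \<epsilon>_def)
  have \<epsilon>: "V x \<bullet> V x > k" if "dist y x \<le> \<epsilon>" for x
    using that \<epsilon>'[of x] \<open>\<epsilon>' > 0\<close> by (simp add: \<epsilon>_def dist_commute)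
  show ?thesis
  proof (cases "dist y x \<le> \<epsilon>")
    case True
    then show ?thesis using \<epsilon>[of x] \<open>k > 0\<close> by auto
  next
    case False
    \<comment> \<open>Chosen so that \<open>\<alpha>\<close> times the squared distance from
      \<open>y\<close> is at least 1 outside the inner ball; the sign of \<open>s''\<close> depends
      on this.\<close>
    define \<alpha> where "\<alpha> = 1 / \<epsilon>^2"
    have "\<alpha> > 0" using \<open>\<epsilon> > 0\<close> by (simp add: \<alpha>_def)
    define \<psi> where "\<psi> = (\<lambda>x. k * (exp (- \<alpha> * ((x - y) \<bullet> (x - y))) - exp (- \<alpha> * R^2)))"
    define F where "F = (\<lambda>x. V x \<bullet> V x - \<psi> x)"
    define K where "K = cball y R - ball y \<epsilon>"
    have "x \<in> K" using False \<open>dist y x < R\<close> by (simp add: K_def)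
    have "compact K" by (simp add: K_def compact_diff)
    moreover have "continuous_on K F"
      unfolding F_def \<psi>_def using S(2)
      by (intro continuous_intros continuous_on_subset[OF cV]) (auto simp: K_def)
    ultimately obtain z where "z \<in> K" and z: "\<And>x. x \<in> K \<Longrightarrow> F z \<le> F x"
      using continuous_attains_inf[of K F] \<open>x \<in> K\<close> by blast
    have "F z \<ge> 0"
    proof (rule ccontr)
      assume "\<not> F z \<ge> 0"
      then have "V z \<bullet> V z < \<psi> z" by (simp add: F_def)
      define U where "U = ball y R - cball y \<epsilon>"
      have U: "open U" "U \<subseteq> K" "U \<subseteq> S" using S(2) by (auto simp: U_def K_def)
      have dist2: "(x - y) \<bullet> (x - y) = (dist y x)^2" for x
        by (simp add: dist_norm power2_norm_eq_inner norm_minus_commute)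
      define e where "e = exp (- \<alpha> * ((z - y) \<bullet> (z - y)))"
      have "e > 0" by (simp add: e_def)
      have "\<psi> z < k * e" using \<open>k > 0\<close> by (simp add: \<psi>_def e_def algebra_simps)
      have "e \<le> 1" using \<open>\<alpha> > 0\<close> by (simp add: e_def)
      have "z \<in> U"
      proof -
        have "dist y z \<noteq> R"
        proof
          assume "dist y z = R"
          then have "\<psi> z = 0" by (simp add: \<psi>_def dist2)
          then show False using \<open>V z \<bullet> V z < \<psi> z\<close> inner_ge_zero[of "V z"] by linarith
        qed
        moreover have "\<not> dist y z \<le> \<epsilon>"
        proof
          assume "dist y z \<le> \<epsilon>"
          then have "k < \<psi> z" using \<epsilon>[of z] \<open>V z \<bullet> V z < \<psi> z\<close> by linarith
          also have "\<psi> z \<le> k" using \<open>\<psi> z < k * e\<close> mult_left_le[OF \<open>e \<le> 1\<close>, of k] \<open>k > 0\<close> by linarith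
          finally show False by simp
        qed
        ultimately show ?thesis using \<open>z \<in> K\<close> by (auto simp: U_def K_def)
      qed
      then have "z \<in> S" using U by blast
      let ?B = "A z (V z)"
      \<comment> \<open>First-order condition at the interior minimum; self-adjointness turns it
        into the radial formula \<open>B_eq\<close>.\<close>
      have "(F has_derivative (\<lambda>\<xi>. 2 * (A z \<xi> \<bullet> V z) + k * (e * (\<alpha> * (2 * ((z - y) \<bullet> \<xi>)))))) (at z)"
        unfolding F_def \<psi>_def e_def
        by (rule derivative_eq_intros V[OF \<open>z \<in> S\<close>] refl)+ (simp add: fun_eq_iff algebra_simps inner_commute)
      from differential_zero_maxmin[OF \<open>z \<in> U\<close> U(1) this] z U(2)
      have D0: "(\<lambda>\<xi>. 2 * (A z \<xi> \<bullet> V z) + k * (e * (\<alpha> * (2 * ((z - y) \<bullet> \<xi>))))) = (\<lambda>_. 0)"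
        by blast
      have "?B \<bullet> \<xi> = (- (k * e * \<alpha>) *\<^sub>R (z - y)) \<bullet> \<xi>" for \<xi>
      proof -
        have "A z \<xi> \<bullet> V z + k * (e * (\<alpha> * ((z - y) \<bullet> \<xi>))) = 0"
          using fun_cong[OF D0, of \<xi>] by linarith
        moreover have "A z \<xi> \<bullet> V z = ?B \<bullet> \<xi>"
          using sym[OF \<open>z \<in> S\<close>, of \<xi> "V z"] by (simp only: inner_commute)
        ultimately show ?thesis
          by (simp only: inner_scaleR_left mult_minus_left mult.assoc)
      qed
      then have B_eq: "?B = - (k * e * \<alpha>) *\<^sub>R (z - y)"
        using vector_eq_rdot by blast
      define c where "c = (\<lambda>t. z + t *\<^sub>R V z + (t^2 / 2) *\<^sub>R ?B)"
      obtain d \<omega> where "d > 0" and cU: "\<And>t. \<bar>t\<bar> < d \<Longrightarrow> c t \<in> U"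
        and \<omega>: "\<And>t. \<bar>t\<bar> < d \<Longrightarrow> ((\<lambda>t. V (c t) \<bullet> V (c t)) has_real_derivative \<omega> t) (at t)"
        and \<omega>0: "(\<omega> has_real_derivative 0) (at 0)"
      proof (rule norm_squared_flat_along_flow[OF U(1) \<open>z \<in> U\<close>])
        fix x assume "x \<in> U"
        then have "x \<in> S" using U(3) by blast
        then show "(V has_derivative A x) (at x)" "A x (V x) \<bullet> V x = 0"
          "\<And>\<xi> \<eta>. A x \<xi> \<bullet> \<eta> = \<xi> \<bullet> A x \<eta>"
          by (fact V null sym)+
      next
        show "continuous_on U (\<lambda>x. A x (V x))"
          using cont U(3) by (rule continuous_on_subset)
      qed (rule that[unfolded c_def])
      have c0: "c 0 = z" by (simp add: c_def)
      \<comment> \<open>Squared distance from \<open>y\<close> along \<open>c\<close>; the barrier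
        depends on position only through it.\<close>
      define s where "s = (\<lambda>t. (c t - y) \<bullet> (c t - y))"
      define s' where "s' = (\<lambda>t. 2 * ((c t - y) \<bullet> (V z + t *\<^sub>R ?B)))"
      define s'' where "s'' = 2 * (V z \<bullet> V z + (z - y) \<bullet> ?B)"
      have c': "(c has_derivative (\<lambda>h. h *\<^sub>R (V z + t *\<^sub>R ?B))) (at t)" for t
        unfolding c_def by (auto intro!: derivative_eq_intros simp: algebra_simps)
      have s: "(s has_real_derivative s' t) (at t)" for t
        unfolding s_def s'_def has_field_derivative_def
        by (rule derivative_eq_intros c' refl)+ (simp add: fun_eq_iff algebra_simps inner_commute)
      have s': "(s' has_real_derivative s'') (at 0)"
        unfolding s'_def s''_def has_field_derivative_def
        by (rule derivative_eq_intros c' refl)+ (simp add: fun_eq_iff c0 algebra_simps inner_commute)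
      \<comment> \<open>The chain is \<open>V z \<bullet> V z < \<psi> z < k * e\<close>, and
        \<open>k * e\<close> is at most \<open>- ((z - y) \<bullet> ?B)\<close> by
        \<open>B_eq\<close> and the choice of \<open>\<alpha>\<close>.\<close>
      have "s'' < 0"
      proof -
        have "1 \<le> \<alpha> * ((z - y) \<bullet> (z - y))"
          using \<open>z \<in> U\<close> \<open>\<epsilon> > 0\<close> by (simp add: U_def \<alpha>_def dist2 field_simps)
        then have "k * e * 1 \<le> k * e * (\<alpha> * ((z - y) \<bullet> (z - y)))"
          using \<open>k > 0\<close> \<open>e > 0\<close> by (intro mult_left_mono) auto
        moreover have "(z - y) \<bullet> ?B = - (k * e * (\<alpha> * ((z - y) \<bullet> (z - y))))"
          unfolding B_eq by simp
        ultimately show ?thesis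
          using \<open>V z \<bullet> V z < \<psi> z\<close> \<open>\<psi> z < k * e\<close> by (simp add: s''_def)
      qed
      \<comment> \<open>Derivative of \<open>F\<close> along \<open>c\<close>. As
        \<open>\<omega>\<close> has derivative 0 at 0, only the barrier contributes to the second
        derivative there.\<close>
      define f' where "f' = (\<lambda>t. \<omega> t + k * \<alpha> * (exp (- \<alpha> * s t) * s' t))"
      have "(\<lambda>t. F (c t)) = (\<lambda>t. V (c t) \<bullet> V (c t) - k * (exp (- \<alpha> * s t) - exp (- \<alpha> * R^2)))"
        by (simp add: F_def \<psi>_def s_def)
      then have "((\<lambda>t. F (c t)) has_real_derivative f' t) (at t)" if "\<bar>t\<bar> < d" for t
        unfolding f'_def using \<omega>[OF that] s[of t]
        by (auto intro!: derivative_eq_intros simp: algebra_simps)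
      moreover have "exp (- \<alpha> * s 0) = e" by (simp add: e_def s_def c0)
      then have "(f' has_real_derivative k * \<alpha> * (e * (s'' - \<alpha> * (s' 0)^2))) (at 0)"
        unfolding f'_def using \<omega>0 s[of 0] s'
        by (auto intro!: derivative_eq_intros simp: algebra_simps power2_eq_square)
      moreover have "k * \<alpha> * (e * (s'' - \<alpha> * (s' 0)^2)) < 0"
      proof -
        have "0 \<le> \<alpha> * (s' 0)^2" using \<open>\<alpha> > 0\<close> by simp
        then have "s'' - \<alpha> * (s' 0)^2 < 0" using \<open>s'' < 0\<close> by linarith
        then show ?thesis using \<open>k > 0\<close> \<open>\<alpha> > 0\<close> \<open>e > 0\<close> by (simp add: mult_pos_neg)
      qed
      moreover have "F (c 0) \<le> F (c t)" if "\<bar>t\<bar> < d" for t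
        using z cU[OF that] U(2) by (auto simp: c0)
      ultimately show False
        by (rule no_local_min_if_second_derivative_neg[OF \<open>d > 0\<close>])
    qed
    \<comment> \<open>The barrier is positive inside the open ball of radius \<open>R\<close> and
      bounds \<open>V x \<bullet> V x\<close> from below.\<close>
    have "(x - y) \<bullet> (x - y) < R^2"
      using \<open>dist y x < R\<close> \<open>R > 0\<close>
      by (simp add: dist_norm norm_minus_commute power_strict_mono flip: power2_norm_eq_inner)
    then have "\<psi> x > 0" using \<open>k > 0\<close> \<open>\<alpha> > 0\<close> by (simp add: \<psi>_def)
    also have "\<psi> x \<le> V x \<bullet> V x" using \<open>F z \<ge> 0\<close> z[OF \<open>x \<in> K\<close>] by (simp add: F_def)
    finally show ?thesis by auto
  qed
qed

text \<open>The radius in \<open>nonzero_in_ball\<close> is limited only by \<open>S\<close>, not by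
  the size of \<open>V y\<close>. Hence a nonzero value very near a zero would exclude that zero, so
  the zero set is open.\<close>

lemma nowhere_zero_or_identically_zero:
  fixes V :: "'a::euclidean_space \<Rightarrow> 'a"
  assumes "open S" "connected S"
    and V: "\<And>x. x \<in> S \<Longrightarrow> (V has_derivative A x) (at x)"
    and sym: "\<And>x \<xi> \<eta>. x \<in> S \<Longrightarrow> A x \<xi> \<bullet> \<eta> = \<xi> \<bullet> A x \<eta>"
    and null: "\<And>x. x \<in> S \<Longrightarrow> A x (V x) \<bullet> V x = 0"
    and cont: "continuous_on S (\<lambda>x. A x (V x))"
  shows "(\<forall>x\<in>S. V x \<noteq> 0) \<or> (\<forall>x\<in>S. V x = 0)"
proof -
  define Z where "Z = {x \<in> S. V x = 0}"
  have cV: "continuous_on S V"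
    using V by (meson continuous_at_imp_continuous_on has_derivative_continuous)
  have "open Z"
    unfolding open_contains_ball
  proof
    fix x assume "x \<in> Z"
    then have "x \<in> S" "V x = 0" by (auto simp: Z_def)
    obtain r where "r > 0" "ball x r \<subseteq> S"
      using \<open>open S\<close> \<open>x \<in> S\<close> open_contains_ball by blast
    \<comment> \<open>The fractions fit because 1/3 + 1/2 < 1 keeps the ball around \<open>y\<close>
      inside \<open>ball x r\<close>, while 1/3 < 1/2 puts \<open>x\<close> inside it.\<close>
    have "V y = 0" if y: "dist x y < r / 3" for y
    proof (rule ccontr)
      assume "V y \<noteq> 0"
      have "w \<in> ball x r" if "dist y w \<le> r / 2" for w
        using that y \<open>r > 0\<close> dist_triangle[of x w y] by simp
      then have "cball y (r / 2) \<subseteq> S"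
        using \<open>ball x r \<subseteq> S\<close> by auto
      moreover have "dist y x < r / 2" using y \<open>r > 0\<close> by (simp add: dist_commute)
      ultimately have "V x \<noteq> 0"
        using nonzero_in_ball[OF \<open>open S\<close> _ V sym null cont \<open>V y \<noteq> 0\<close>] by blast
      then show False using \<open>V x = 0\<close> by simp
    qed
    moreover have "ball x (r / 3) \<subseteq> S" using \<open>ball x r \<subseteq> S\<close> \<open>r > 0\<close> by (auto simp: subset_iff)
    ultimately show "\<exists>e>0. ball x e \<subseteq> Z"
      using \<open>r > 0\<close> by (intro exI[of _ "r / 3"]) (auto simp: Z_def)
  qed
  moreover have "closedin (top_of_set S) Z"
    unfolding Z_def using cV by (rule continuous_closedin_preimage_constant)
  ultimately have "Z = {} \<or> Z = S"
    using \<open>connected S\<close> \<open>open S\<close> unfolding connected_clopen Z_def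
    by (metis (no_types, lifting) openin_open_eq mem_Collect_eq subsetI)
  then show ?thesis by (auto simp: Z_def)
qed

section \<open>From partial derivatives to the gradient and Hessian as total derivatives\<close>

lemma C1_on_has_derivative_gradient:
  assumes "C1_on S f" "open S" "x \<in> S"
  shows "(f has_derivative (\<lambda>h. gradient f x \<bullet> h)) (at x)"
proof -
  let ?D = "frechet_derivative f (at x)"
  have "(f has_derivative ?D) (at x)"
    using assms by (simp add: C1_on_def differentiable_on_eq_differentiable_at frechet_derivative_works)
  moreover have "?D h = gradient f x \<bullet> h" for h
  proof -
    have lin: "linear ?D" using calculation by (rule has_derivative_linear)
    have "?D h = ?D (\<Sum>i\<in>UNIV. h $ i *\<^sub>R axis i 1)"
      using basis_expansion[of h] by (simp add: scalar_mult_eq_scaleR)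
    also have "\<dots> = (\<Sum>i\<in>UNIV. h $ i * ?D (axis i 1))"
      by (simp add: linear_sum[OF lin] linear_cmul[OF lin])
    also have "\<dots> = gradient f x \<bullet> h"
      by (simp add: inner_vec_def gradient_def partial_deriv_def mult.commute)
    finally show ?thesis .
  qed
  then have "?D = (\<lambda>h. gradient f x \<bullet> h)" by (rule ext)
  ultimately show ?thesis by simp
qed

lemma continuous_on_gradient: "C1_on S f \<Longrightarrow> continuous_on S (gradient f)"
  unfolding gradient_def C1_on_def by (intro continuous_on_vec_lambda) auto

lemma hessian_symmetric:
  assumes "C2_on S u" "open S" "x \<in> S"
  shows "transpose (hessian u x) = hessian u x"
proof -
  have "partial_deriv i (partial_deriv j u) x = partial_deriv j (partial_deriv i u) x" for i j
  proof -
    have axis: "gradient f y \<bullet> axis k 1 = partial_deriv k f y" for f k and y :: "real ^ 'a"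
      by (simp add: inner_axis gradient_def)
    have C1: "C1_on S u" "\<And>k. C1_on S (partial_deriv k u)"
      using assms(1) by (simp_all add: C2_on_def)
    note deriv = C1_on_has_derivative_gradient[OF _ \<open>open S\<close>]
    show ?thesis
      using second_derivative_symmetric[OF \<open>open S\<close> \<open>x \<in> S\<close> deriv[OF C1(1)],
          of "axis j 1" "\<lambda>y h. gradient (partial_deriv j u) y \<bullet> h"
             "axis i 1" "\<lambda>y h. gradient (partial_deriv i u) y \<bullet> h"]
        deriv[OF C1(2)] C1(2)
      by (simp add: axis C1_on_def)
  qed
  then show ?thesis by (simp add: vec_eq_iff transpose_def hessian_def)
qed

lemma inner_hessian:
  assumes "C2_on S u" "open S" "x \<in> S"
  shows "(hessian u x *v \<xi>) \<bullet> \<eta> = \<xi> \<bullet> (hessian u x *v \<eta>)"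
  by (metis assms dot_lmul_matrix hessian_symmetric transpose_matrix_vector)

text \<open>Component \<open>j\<close> of the gradient has the entries of column \<open>j\<close> of
  the Hessian as partial derivatives, so the transpose appears first and symmetry removes
  it.\<close>

lemma C2_on_has_derivative_hessian:
  assumes "C2_on S u" "open S" "x \<in> S"
  shows "(gradient u has_derivative (\<lambda>h. hessian u x *v h)) (at x)"
proof (subst has_derivative_componentwise_within, intro ballI)
  fix b :: "real ^ 'a" assume "b \<in> Basis"
  then obtain j where b: "b = axis j 1" by (auto simp: Basis_vec_def)
  have "(partial_deriv j u has_derivative (\<lambda>h. gradient (partial_deriv j u) x \<bullet> h)) (at x)"
    using assms by (intro C1_on_has_derivative_gradient) (auto simp: C2_on_def)
  moreover have "gradient (partial_deriv j u) x \<bullet> h = (hessian u x *v h) \<bullet> b" for h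
  proof -
    have "gradient (partial_deriv j u) x \<bullet> h = (transpose (hessian u x) *v h) $ j"
      by (simp add: matrix_vector_mult_def transpose_def hessian_def gradient_def inner_vec_def)
    then show ?thesis by (simp add: hessian_symmetric[OF assms] b inner_axis)
  qed
  ultimately show "((\<lambda>x. gradient u x \<bullet> b) has_derivative (\<lambda>h. (hessian u x *v h) \<bullet> b)) (at x)"
    by (simp add: b inner_axis gradient_def)
qed

lemma continuous_on_hessian_mult:
  assumes "C2_on S u" "continuous_on S v"
  shows "continuous_on S (\<lambda>x. hessian u x *v v x)"
  using assms unfolding matrix_vector_mult_def hessian_def C2_on_def C1_on_def
  by (auto intro!: continuous_on_vec_lambda continuous_on_sum continuous_on_mult continuous_on_component)

section \<open>Removing the term with \<open>g\<close> by a change of the dependent variable\<close>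

lemma antiderivative_exists:
  fixes g :: "real \<Rightarrow> real"
  assumes "continuous_on UNIV g"
  obtains G where "\<And>s. (G has_real_derivative g s) (at s)"
  using einterval_antiderivative[of "-\<infinity>" "\<infinity>" g] assms
  by (auto simp: continuous_on_eq_continuous_at has_real_derivative_iff_has_vector_derivative)

theorem theorem3:
  fixes g :: "real \<Rightarrow> real"
    and \<Omega> :: "(real ^ 'n) set"
    and u :: "real ^ 'n \<Rightarrow> real"
  assumes "continuous_on UNIV g"
    and "\<exists>s0\<ge>0. (\<forall>s\<in>{s0..}. g s \<ge> 0) \<and> (\<forall>s\<in>{..-s0}. g s \<le> 0)"
    and "open \<Omega>" and "connected \<Omega>"
    and "C2_on \<Omega> u"
    and "\<forall>x\<in>\<Omega>. infinity_laplacian u x + g (u x) * norm (gradient u x) ^ 4 = 0"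
  shows "(\<forall>x\<in>\<Omega>. gradient u x \<noteq> 0) \<or> u constant_on \<Omega>"
proof -
  note C2 = \<open>C2_on \<Omega> u\<close> and op = \<open>open \<Omega>\<close>
  have C1: "C1_on \<Omega> u" using C2 by (simp add: C2_on_def)
  obtain G where G: "\<And>s. (G has_real_derivative g s) (at s)"
    using antiderivative_exists[OF assms(1)] by blast
  note u' = C1_on_has_derivative_gradient[OF C1 op]
  have cu: "continuous_on \<Omega> u"
    using u' by (meson continuous_at_imp_continuous_on has_derivative_continuous)
  have "isCont G s" for s using G DERIV_isCont by blast
  then have cG: "continuous_on \<Omega> (\<lambda>x. G (u x))"
    by (intro continuous_on_compose2[OF _ cu, of UNIV]) (auto intro: continuous_at_imp_continuous_on)
  have cg: "continuous_on \<Omega> (\<lambda>x. g (u x))"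
    by (rule continuous_on_compose2[OF assms(1) cu]) simp
  define E where "E = (\<lambda>x. exp (G (u x)))"
  define V where "V = (\<lambda>x. E x *\<^sub>R gradient u x)"
  \<comment> \<open>Product rule for \<open>V\<close>. The second summand is a multiple of the
    rank-one map built from \<open>gradient u x\<close>, hence self-adjoint like the
    Hessian.\<close>
  define A where "A = (\<lambda>x h. E x *\<^sub>R (hessian u x *v h)
    + (E x * (g (u x) * (gradient u x \<bullet> h))) *\<^sub>R gradient u x)"
  have V': "(V has_derivative A x) (at x)" if "x \<in> \<Omega>" for x
  proof -
    have "((\<lambda>x. G (u x)) has_derivative (\<lambda>h. g (u x) * (gradient u x \<bullet> h))) (at x)"
      using has_derivative_compose[OF u'[OF that] G[unfolded has_field_derivative_def]] .
    then show ?thesis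
      unfolding V_def A_def E_def
      using C2_on_has_derivative_hessian[OF C2 op that]
      by (auto intro!: derivative_eq_intros)
  qed
  have sym: "A x \<xi> \<bullet> \<eta> = \<xi> \<bullet> A x \<eta>" if "x \<in> \<Omega>" for x \<xi> \<eta>
    using inner_hessian[OF C2 op that, of \<xi> \<eta>]
    by (simp add: A_def inner_add_left inner_add_right inner_commute)
  have null: "A x (V x) \<bullet> V x = 0" if "x \<in> \<Omega>" for x
  proof -
    \<comment> \<open>Each of the two factors \<open>V x\<close> and the map \<open>A x\<close>
      contributes one \<open>E x\<close>; the rest is the left side of the equation.\<close>
    have "A x (V x) \<bullet> V x
        = E x ^ 3 * (infinity_laplacian u x + g (u x) * (gradient u x \<bullet> gradient u x)^2)"
      by (simp add: A_def V_def infinity_laplacian_def matrix_vector_mult_scaleR inner_add_left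
          algebra_simps power2_eq_square power3_eq_cube)
    also have "(gradient u x \<bullet> gradient u x)^2 = norm (gradient u x) ^ 4"
      by (simp flip: power2_norm_eq_inner)
    finally show ?thesis using assms(6) that by simp
  qed
  have "continuous_on \<Omega> (\<lambda>x. A x (V x))"
    unfolding A_def V_def E_def
    by (intro continuous_intros continuous_on_hessian_mult[OF C2] continuous_on_gradient[OF C1] cG cg)
  from nowhere_zero_or_identically_zero[OF op \<open>connected \<Omega>\<close> V' sym null this]
  consider "\<forall>x\<in>\<Omega>. gradient u x \<noteq> 0" | "\<forall>x\<in>\<Omega>. gradient u x = 0"
    by (auto simp: V_def E_def)
  then show ?thesis
  proof cases
    case 2
    then have "(u has_derivative (\<lambda>h. 0)) (at x within \<Omega>)" if "x \<in> \<Omega>" for x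
      using u'[OF that] that by (simp add: has_derivative_at_withinI)
    then show ?thesis
      using has_derivative_zero_connected_constant_on[OF \<open>connected \<Omega>\<close> op finite.emptyI cu] by simp
  qed simp
qed

end
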